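(* Let $G$ be a bounded continuous function on $\mathbb{R}^{2n}$ and let $A=Op^{AW}(G)$ be the anti-Wick operator associated with $G$. Then, for all $X,Y\in\mathbb{R}^{2n}$, $$|\langle A\Psi_X,\Psi_Y\rangle|\le \|G\|_\infty\, e^{-\frac18|X-Y|^2}.$$
   Context: Here $\langle f,g\rangle=\int_{\mathbb{R}^n} f(u)\overline{g(u)}\,du$ is the $L^2(\mathbb{R}^n)$ inner product, and $|\cdot|$ is the Euclidean norm. For $X=(x,\xi)\in\mathbb{R}^{2n}$ (with $x,\xi\in\mathbb{R}^n$), the coherent state $\Psi_X\in L^2(\mathbb{R}^n)$ is $$\Psi_{x,\xi}(u)=\pi^{-n/4}e^{-\frac12|u-x|^2+iu\cdot\xi-\frac i2 x\cdot\xi}.$$ For $G$ bounded and continuous on $\mathbb{R}^{2n}$, the anti-Wick operator $Op^{AW}(G)$ is the unique (bounded) operator in $L^2(\mathbb{R}^n)$ such that for all $f,g\in L^2(\mathbb{R}^n)$ $$\langle Op^{AW}(G)f,g\rangle=(2\pi)^{-n}\int_{\mathbb{R}^{2n}}G(Z)\,\langle f,\Psi_Z\rangle\langle\Psi_Z,g\rangle\,dZ.$$ $\|G\|_\infty$ denotes the supremum norm of $G$ on $\mathbb{R}^{2n}$. *)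

theory Defs
  imports "HOL-Analysis.Analysis"
begin

text \<open>
  $L^2(R^n)$ is handled through square-integrable representatives \<open>real ^ 'n \<Rightarrow> complex\<close>,
  with $n$ = \<open>CARD('n)\<close> and equality in $L^2$ rendered as equality almost everywhere. Every
  Lebesgue measurable function has a Borel measurable representative, so \<open>lborel\<close>
  yields the usual space. Phase space $R^{2n}$ is \<open>(real ^ 'n) \<times> (real ^ 'n)\<close>, whose library norm
  is the Euclidean one.
\<close>

definition L2 :: "((real ^ 'n) \<Rightarrow> complex) set" where
  "L2 = {f. f \<in> borel_measurable lborel \<and> integrable lborel (\<lambda>u. (norm (f u))\<^sup>2)}"

definition L2_inner :: "((real ^ 'n) \<Rightarrow> complex) \<Rightarrow> ((real ^ 'n) \<Rightarrow> complex) \<Rightarrow> complex" where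
  "L2_inner f g = (LINT u|lborel. f u * cnj (g u))"

definition L2_norm :: "((real ^ 'n) \<Rightarrow> complex) \<Rightarrow> real" where
  "L2_norm f = sqrt (LINT u|lborel. (norm (f u))\<^sup>2)"

text \<open>
  A bounded linear operator of $L^2$, acting on representatives: the second condition
  says that it descends to classes modulo null sets. Its values outside \<open>L2\<close> are irrelevant.
\<close>

definition bounded_L2_operator ::
  "(((real ^ 'n) \<Rightarrow> complex) \<Rightarrow> ((real ^ 'n) \<Rightarrow> complex)) \<Rightarrow> bool" where
  "bounded_L2_operator A \<longleftrightarrow>
     (\<forall>f\<in>L2. A f \<in> L2) \<and>
     (\<forall>f\<in>L2. \<forall>g\<in>L2. (AE u in lborel. f u = g u) \<longrightarrow> (AE u in lborel. A f u = A g u)) \<and>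
     (\<forall>f\<in>L2. \<forall>g\<in>L2. AE u in lborel. A (\<lambda>v. f v + g v) u = A f u + A g u) \<and>
     (\<forall>c. \<forall>f\<in>L2. AE u in lborel. A (\<lambda>v. c * f v) u = c * A f u) \<and>
     (\<exists>C. \<forall>f\<in>L2. L2_norm (A f) \<le> C * L2_norm f)"

definition coherent_state :: "(real ^ 'n) \<times> (real ^ 'n) \<Rightarrow> (real ^ 'n) \<Rightarrow> complex" where
  "coherent_state = (\<lambda>(x, \<xi>) u.
     of_real (pi powr (- real CARD('n) / 4)) *
     exp (- of_real ((norm (u - x))\<^sup>2) / 2 + \<i> * of_real (u \<bullet> \<xi>) - \<i> / 2 * of_real (x \<bullet> \<xi>)))"

text \<open>
  The characterisation of $Op^{AW}(G)$, which determines the operator up to equality almost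
  everywhere of its values. For \<open>f\<close>, \<open>g\<close> in \<open>L2\<close> and bounded continuous \<open>G\<close> the integral over
  phase space is absolutely convergent.
\<close>

definition is_anti_wick_operator ::
  "((real ^ 'n) \<times> (real ^ 'n) \<Rightarrow> complex) \<Rightarrow>
   (((real ^ 'n) \<Rightarrow> complex) \<Rightarrow> ((real ^ 'n) \<Rightarrow> complex)) \<Rightarrow> bool" where
  "is_anti_wick_operator G A \<longleftrightarrow>
     bounded_L2_operator A \<and>
     (\<forall>f\<in>L2. \<forall>g\<in>L2.
        L2_inner (A f) g =
        of_real (inverse ((2 * pi) ^ CARD('n))) *
        (LINT Z|lborel. G Z * L2_inner f (coherent_state Z) * L2_inner (coherent_state Z) g))"

definition sup_norm :: "((real ^ 'n) \<times> (real ^ 'n) \<Rightarrow> complex) \<Rightarrow> real" where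
  "sup_norm G = (SUP Z. norm (G Z))"

end

theory Submission
  imports Defs "HOL-Probability.Characteristic_Functions"
begin

text \<open>
  The Gaussian overlap $|\langle\Psi_X,\Psi_Z\rangle| = e^{-|X-Z|^2/4}$ bounds the integrand of
  $\langle A\Psi_X,\Psi_Y\rangle$ by $\|G\|_\infty e^{-(|Z-X|^2+|Z-Y|^2)/4}$. With $M = (X+Y)/2$ the
  exponent equals $-|X-Y|^2/8 - |Z-M|^2/2$, and $\int e^{-|Z-M|^2/2}\,dZ = (2\pi)^n$ cancels the
  normalisation.
\<close>

section \<open>Fourier integrals of Gaussians, from the real line to Euclidean spaces\<close>

text \<open>The value is the known characteristic function of the standard normal distribution,
  rewritten from a measure with density to an integral over \<open>lborel\<close>. The phase has
  modulus one, so the density itself dominates the integrand.\<close>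

lemma has_bochner_integral_std_normal_char:
  "has_bochner_integral lborel
     (\<lambda>x. std_normal_density x *\<^sub>R exp (\<i> * of_real (t * x))) (of_real (exp (- t\<^sup>2 / 2)))"
proof -
  have "integrable lborel (\<lambda>x. std_normal_density x *\<^sub>R exp (\<i> * of_real (t * x)))"
  proof (rule Bochner_Integration.integrable_bound)
    show "integrable lborel std_normal_density"
      using integrable_normal_moment[of 0 1 0] by simp
  qed (auto simp: norm_exp_i_times)
  moreover have "(LINT x|lborel. std_normal_density x *\<^sub>R exp (\<i> * of_real (t * x))) =
      of_real (exp (- t\<^sup>2 / 2))"
    using fun_cong[OF char_std_normal_distribution, of t]
    by (simp add: char_def integral_density)
  ultimately show ?thesis
    by (simp add: has_bochner_integral_iff)
qed

text \<open>The substitution x = m + c y reduces the integral to the standard normal case at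
  frequency \<open>k * c\<close>; the shift by \<open>m\<close> only contributes the phase of
  frequency \<open>k\<close> at \<open>m\<close>.\<close>

lemma has_bochner_integral_gaussian_real:
  fixes a m k :: real
  assumes a: "a > 0"
  shows "has_bochner_integral lborel
     (\<lambda>x. exp (of_real (- a * (x - m)\<^sup>2) + \<i> * of_real (x * k)))
     (of_real (sqrt (pi / a)) * exp (of_real (- k\<^sup>2 / (4 * a)) + \<i> * of_real (m * k)))"
proof -
  \<comment> \<open>This scale gives \<open>a * c\<^sup>2 = 1 / 2\<close>, the exponent of the
    standard normal density.\<close>
  define c where "c = 1 / sqrt (2 * a)"
  have c: "c > 0" "a * c\<^sup>2 = 1 / 2"
    using a by (simp_all add: c_def power_divide)
  have c2: "c\<^sup>2 = 1 / (2 * a)"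
    using a by (simp add: c_def power_divide)
  have sq: "sqrt (2 * pi) = sqrt (pi / a) / c"
    using a by (simp add: c_def real_sqrt_divide real_sqrt_mult)
  \<comment> \<open>The root undoes the normalisation of \<open>std_normal_density\<close>; the
    exponential is the phase produced by the shift.\<close>
  let ?C = "of_real (sqrt (2 * pi)) * exp (\<i> * of_real (m * k)) :: complex"
  have eq: "exp (of_real (- a * ((m + c * y) - m)\<^sup>2) + \<i> * of_real ((m + c * y) * k)) =
      ?C * (std_normal_density y *\<^sub>R exp (\<i> * of_real (k * c * y)))" for y
  proof -
    have "- a * ((m + c * y) - m)\<^sup>2 = - (a * c\<^sup>2) * y\<^sup>2"
      by (simp add: power_mult_distrib)
    also have "\<dots> = - y\<^sup>2 / 2"
      unfolding c by simp
    finally have 1: "- a * ((m + c * y) - m)\<^sup>2 = - y\<^sup>2 / 2" .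
    have "?C * (std_normal_density y *\<^sub>R exp (\<i> * of_real (k * c * y))) =
        of_real (exp (- y\<^sup>2 / 2)) * (exp (\<i> * of_real (m * k)) * exp (\<i> * of_real (k * c * y)))"
      by (simp add: std_normal_density_def scaleR_conv_of_real flip: of_real_mult)
    also have "\<dots> = exp (of_real (- y\<^sup>2 / 2) + (\<i> * of_real (m * k) + \<i> * of_real (k * c * y)))"
      by (simp only: exp_add exp_of_real)
    also have "\<i> * complex_of_real (m * k) + \<i> * of_real (k * c * y) = \<i> * of_real ((m + c * y) * k)"
      by (simp add: algebra_simps)
    finally show ?thesis
      unfolding 1 by simp
  qed
  \<comment> \<open>The affine change of variables divides the value of the integral by the Jacobian
    \<open>\<bar>c\<bar>\<close>.\<close>
  have val: "(of_real (sqrt (pi / a)) * exp (of_real (- k\<^sup>2 / (4 * a)) + \<i> * of_real (m * k))) /\<^sub>R \<bar>c\<bar> =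
      ?C * of_real (exp (- (k * c)\<^sup>2 / 2))"
  proof -
    have "- (k * c)\<^sup>2 / 2 = - k\<^sup>2 / (4 * a)"
      by (simp add: power_mult_distrib c2)
    then have "exp (of_real (- k\<^sup>2 / (4 * a)) + \<i> * of_real (m * k)) =
        exp (\<i> * of_real (m * k)) * (of_real (exp (- (k * c)\<^sup>2 / 2)) :: complex)"
      by (simp only: exp_add exp_of_real mult.commute)
    moreover have "of_real (sqrt (pi / a)) /\<^sub>R \<bar>c\<bar> = (of_real (sqrt (2 * pi)) :: complex)"
      using c(1) by (simp add: sq scaleR_conv_of_real divide_simps)
    ultimately show ?thesis
      by (metis mult.assoc mult_scaleR_left)
  qed
  have "has_bochner_integral lborel
      (\<lambda>y. ?C * (std_normal_density y *\<^sub>R exp (\<i> * of_real (k * c * y))))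
      (?C * of_real (exp (- (k * c)\<^sup>2 / 2)))"
    by (rule has_bochner_integral_mult_right) (rule has_bochner_integral_std_normal_char)
  then show ?thesis
    unfolding eq[symmetric] val[symmetric]
    by (rule iffD2[OF lborel_has_bochner_integral_real_affine_iff, rotated]) (use c(1) in simp)
qed

text \<open>Fubini for finitely many factors: \<open>lborel\<close> is the image of the product of
  one-dimensional Lebesgue measures under expansion in the basis, so an integrand that separates in
  the coordinates has a product as its integral.\<close>

lemma has_bochner_integral_lborel_prod:
  fixes f :: "'a::euclidean_space \<Rightarrow> real \<Rightarrow> 'b::{real_normed_field,banach,second_countable_topology}"
  assumes f: "\<And>b. b \<in> Basis \<Longrightarrow> has_bochner_integral lborel (f b) (I b)"
  shows "has_bochner_integral lborel (\<lambda>x. \<Prod>b\<in>Basis. f b (x \<bullet> b)) (\<Prod>b\<in>Basis. I b)"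
proof -
  interpret product_sigma_finite "\<lambda>_::'a. lborel :: real measure"
    by standard
  have int: "integrable lborel (f b)" "integral\<^sup>L lborel (f b) = I b" if "b \<in> Basis" for b
    using f[OF that] by (auto simp: has_bochner_integral_iff)
  have [measurable]: "f b \<in> borel_measurable borel" if "b \<in> Basis" for b
    using int(1)[OF that] by (auto dest: borel_measurable_integrable)
  have coord: "(\<Prod>b\<in>Basis. f b ((\<Sum>i\<in>Basis. x i *\<^sub>R i) \<bullet> b)) = (\<Prod>b\<in>Basis. f b (x b))" for x
    by (intro prod.cong refl) simp
  have "has_bochner_integral (\<Pi>\<^sub>M b\<in>(Basis::'a set). lborel) (\<lambda>x. \<Prod>b\<in>Basis. f b (x b)) (\<Prod>b\<in>Basis. I b)"
    by (auto simp: has_bochner_integral_iff int product_integral_prod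
             intro!: product_integrable_prod prod.cong)
  then show ?thesis
    by (subst lborel_eq)
       (simp add: has_bochner_integral_iff integrable_distr_eq integral_distr coord)
qed

text \<open>The squared norm and the inner product are both sums over coordinates, so the
  exponential is a product of one-dimensional integrands of the same kind.\<close>

lemma has_bochner_integral_gaussian:
  fixes m k :: "'a::euclidean_space"
  assumes a: "a > 0"
  shows "has_bochner_integral lborel
     (\<lambda>u. exp (of_real (- a * (norm (u - m))\<^sup>2) + \<i> * of_real (u \<bullet> k)))
     (of_real (sqrt (pi / a) ^ DIM('a)) *
       exp (of_real (- (norm k)\<^sup>2 / (4 * a)) + \<i> * of_real (m \<bullet> k)))"
proof -
  have norm_sq: "(norm v)\<^sup>2 = (\<Sum>b\<in>Basis. (v \<bullet> b)\<^sup>2)" for v :: 'a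
    unfolding power2_norm_eq_inner by (subst euclidean_inner) (simp add: power2_eq_square)
  have 1: "(\<lambda>u. exp (of_real (- a * (norm (u - m))\<^sup>2) + \<i> * of_real (u \<bullet> k))) =
     (\<lambda>u. \<Prod>b\<in>Basis. exp (of_real (- a * (u \<bullet> b - m \<bullet> b)\<^sup>2) + \<i> * of_real ((u \<bullet> b) * (k \<bullet> b))))"
    by (rule ext)
       (simp add: exp_sum[symmetric] sum.distrib norm_sq euclidean_inner[of _ k] inner_diff_left
          sum_distrib_left sum_negf sum_subtractf)
  have 2: "of_real (sqrt (pi / a) ^ DIM('a)) *
       exp (of_real (- (norm k)\<^sup>2 / (4 * a)) + \<i> * of_real (m \<bullet> k)) =
     (\<Prod>b\<in>(Basis::'a set). of_real (sqrt (pi / a)) *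
        exp (of_real (- (k \<bullet> b)\<^sup>2 / (4 * a)) + \<i> * of_real ((m \<bullet> b) * (k \<bullet> b))))"
    by (simp add: prod.distrib exp_sum[symmetric] sum.distrib norm_sq euclidean_inner[of m k]
          sum_distrib_left sum_divide_distrib sum_negf sum_subtractf)
  show ?thesis
    unfolding 1 2 by (intro has_bochner_integral_lborel_prod has_bochner_integral_gaussian_real a)
qed

text \<open>Real part of the case of frequency zero. It serves position space with \<open>a\<close>
  equal to 1 and phase space with \<open>a\<close> equal to 1/2.\<close>

lemma has_bochner_integral_gaussian_norm:
  fixes m :: "'a::euclidean_space"
  assumes a: "a > 0"
  shows "has_bochner_integral lborel (\<lambda>u. exp (- a * (norm (u - m))\<^sup>2)) (sqrt (pi / a) ^ DIM('a))"
  using has_bochner_integral_Re[OF has_bochner_integral_gaussian[OF a, of m 0]]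
  by (simp add: exp_of_real Re_exp)

text \<open>The parallelogram law for u - x and u - z, whose sum is twice the distance vector from
  the midpoint to u. It completes the square both in the overlap integral and in the final
  phase-space integral.\<close>

lemma parallelogram_midpoint:
  fixes u x z :: "'a::real_inner"
  shows "(norm (u - x))\<^sup>2 + (norm (u - z))\<^sup>2 =
    2 * (norm (u - (1/2) *\<^sub>R (x + z)))\<^sup>2 + (norm (x - z))\<^sup>2 / 2"
  unfolding power2_norm_eq_inner
  by (simp add: algebra_simps inner_commute diff_divide_distrib add_divide_distrib)

text \<open>The prefactors of two coherent states cancel the Gaussian integral with \<open>a\<close>
  equal to 1; this is the normalisation of coherent states to unit norm.\<close>

lemma powr_neg_quarter_sq:
  "(pi powr (- real n / 4))\<^sup>2 * sqrt pi ^ n = 1"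
proof -
  have "(pi powr (- real n / 4))\<^sup>2 = pi powr (- real n / 2)"
    by (simp add: power2_eq_square flip: powr_add)
  moreover have "sqrt pi ^ n = pi powr (real n / 2)"
    by (simp add: powr_half_sqrt[symmetric] powr_powr flip: powr_realpow)
  ultimately show ?thesis
    by (simp flip: powr_add)
qed

section \<open>Square-integrability and overlaps of coherent states\<close>

lemma norm_coherent_state:
  "norm (coherent_state (x, \<xi>) (u :: real ^ 'n)) =
     pi powr (- real CARD('n) / 4) * exp (- (norm (u - x))\<^sup>2 / 2)"
  by (simp add: coherent_state_def norm_mult)

lemma coherent_state_L2: "coherent_state (Z :: (real ^ 'n) \<times> (real ^ 'n)) \<in> L2"
proof -
  obtain x \<xi> where Z: "Z = (x, \<xi>)"
    by (cases Z)
  have "integrable lborel (\<lambda>u. (norm (coherent_state Z u))\<^sup>2)"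
    using has_bochner_integral_gaussian_norm[of 1 x]
    by (simp add: Z norm_coherent_state power_mult_distrib has_bochner_integral_iff
          flip: exp_of_nat_mult)
  moreover have "coherent_state Z \<in> borel_measurable lborel"
    unfolding Z coherent_state_def by (auto intro!: borel_measurable_continuous_onI continuous_intros)
  ultimately show ?thesis
    by (simp add: L2_def)
qed

text \<open>Completing the square in u yields the decay in the position difference, and the Fourier
  transform of the remaining Gaussian at frequency \<xi> - \<zeta> yields the decay in the momentum
  difference. The two exponents add up to the squared phase-space distance.\<close>

lemma norm_L2_inner_coherent_state:
  fixes X Z :: "(real ^ 'n) \<times> (real ^ 'n)"
  shows "norm (L2_inner (coherent_state X) (coherent_state Z)) = exp (- (norm (X - Z))\<^sup>2 / 4)"
proof -
  obtain x \<xi> z \<zeta> where XZ: "X = (x, \<xi>)" "Z = (z, \<zeta>)"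
    by (cases X, cases Z)
  define p where "p = pi powr (- real CARD('n) / 4)"
  define m where "m = (1/2) *\<^sub>R (x + z)"
  \<comment> \<open>All factors independent of u. The imaginary part of the exponent affects only
    the phase, so it disappears once the modulus is taken.\<close>
  define C where "C = of_real (p\<^sup>2) *
    exp (of_real (- (norm (x - z))\<^sup>2 / 4) + \<i> * of_real ((z \<bullet> \<zeta> - x \<bullet> \<xi>) / 2))"
  have eq: "coherent_state X u * cnj (coherent_state Z u) =
      C * exp (of_real (- 1 * (norm (u - m))\<^sup>2) + \<i> * of_real (u \<bullet> (\<xi> - \<zeta>)))" for u
  proof -
    have "cnj (coherent_state Z u) = of_real p *
        exp (- of_real ((norm (u - z))\<^sup>2) / 2 - \<i> * of_real (u \<bullet> \<zeta>) + \<i> / 2 * of_real (z \<bullet> \<zeta>))"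
      by (simp add: XZ coherent_state_def p_def exp_cnj algebra_simps)
    then have "coherent_state X u * cnj (coherent_state Z u) = of_real (p\<^sup>2) *
        exp ((- of_real ((norm (u - x))\<^sup>2) / 2 + \<i> * of_real (u \<bullet> \<xi>) - \<i> / 2 * of_real (x \<bullet> \<xi>)) +
          (- of_real ((norm (u - z))\<^sup>2) / 2 - \<i> * of_real (u \<bullet> \<zeta>) + \<i> / 2 * of_real (z \<bullet> \<zeta>)))"
      unfolding exp_add[of "_ - _"]
      by (simp add: XZ coherent_state_def p_def power2_eq_square)
    also have "(- of_real ((norm (u - x))\<^sup>2) / 2 + \<i> * of_real (u \<bullet> \<xi>) - \<i> / 2 * of_real (x \<bullet> \<xi>)) +
          (- of_real ((norm (u - z))\<^sup>2) / 2 - \<i> * of_real (u \<bullet> \<zeta>) + \<i> / 2 * of_real (z \<bullet> \<zeta>)) =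
        of_real (- ((norm (u - x))\<^sup>2 + (norm (u - z))\<^sup>2) / 2) +
          \<i> * of_real (u \<bullet> (\<xi> - \<zeta>) + (z \<bullet> \<zeta> - x \<bullet> \<xi>) / 2)"
      by (simp add: inner_diff_right algebra_simps add_divide_distrib diff_divide_distrib)
    also have "\<dots> = (of_real (- (norm (x - z))\<^sup>2 / 4) + \<i> * of_real ((z \<bullet> \<zeta> - x \<bullet> \<xi>) / 2)) +
        (of_real (- 1 * (norm (u - m))\<^sup>2) + \<i> * of_real (u \<bullet> (\<xi> - \<zeta>)))"
      unfolding parallelogram_midpoint m_def[symmetric]
      by (simp add: algebra_simps add_divide_distrib diff_divide_distrib)
    finally show ?thesis
      by (simp add: C_def exp_add mult.assoc)
  qed
  have "L2_inner (coherent_state X) (coherent_state Z) =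
      C * (of_real (sqrt pi ^ CARD('n)) *
        exp (of_real (- (norm (\<xi> - \<zeta>))\<^sup>2 / 4) + \<i> * of_real (m \<bullet> (\<xi> - \<zeta>))))"
    unfolding L2_inner_def eq
    using has_bochner_integral_gaussian[of 1 m "\<xi> - \<zeta>"]
    by (simp add: has_bochner_integral_iff)
  then have "norm (L2_inner (coherent_state X) (coherent_state Z)) =
      (p\<^sup>2 * sqrt pi ^ CARD('n)) *
        (exp (- (norm (x - z))\<^sup>2 / 4) * exp (- (norm (\<xi> - \<zeta>))\<^sup>2 / 4))"
    by (simp add: C_def norm_mult norm_power)
  also have "\<dots> = exp (- (norm (X - Z))\<^sup>2 / 4)"
    unfolding p_def powr_neg_quarter_sq
    by (simp add: XZ norm_Pair add_divide_distrib diff_divide_distrib flip: exp_add)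
  finally show ?thesis .
qed

section \<open>Matrix elements of an anti-Wick operator between coherent states\<close>

theorem theorem1p2:
  fixes G :: "(real ^ 'n) \<times> (real ^ 'n) \<Rightarrow> complex"
    and A :: "((real ^ 'n) \<Rightarrow> complex) \<Rightarrow> ((real ^ 'n) \<Rightarrow> complex)"
  assumes "bounded (range G)"
    and "continuous_on UNIV G"
    and "is_anti_wick_operator G A"
  shows "\<forall>X Y. norm (L2_inner (A (coherent_state X)) (coherent_state Y))
           \<le> sup_norm G * exp (- (norm (X - Y))\<^sup>2 / 8)"
proof (intro allI)
  fix X Y :: "(real ^ 'n) \<times> (real ^ 'n)"
  \<comment> \<open>A supremum of reals dominates the values only when they are bounded above; this
    is where boundedness of \<open>G\<close> enters.\<close>
  have "bdd_above (range (\<lambda>Z. norm (G Z)))"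
    using \<open>bounded (range G)\<close> by (simp add: bounded_imp_bdd_above bounded_norm_comp)
  then have G_le: "norm (G Z) \<le> sup_norm G" for Z
    unfolding sup_norm_def by (rule cSUP_upper[OF UNIV_I])
  let ?F = "\<lambda>Z. G Z * L2_inner (coherent_state X) (coherent_state Z) *
    L2_inner (coherent_state Z) (coherent_state Y)"
  let ?M = "(1/2) *\<^sub>R (X + Y)"
  let ?E = "exp (- (norm (X - Y))\<^sup>2 / 8)"
  have F_le: "norm (?F Z) \<le> sup_norm G * (?E * exp (- (1/2) * (norm (Z - ?M))\<^sup>2))" for Z
  proof -
    have "norm (?F Z) = norm (G Z) * exp (- ((norm (Z - X))\<^sup>2 + (norm (Z - Y))\<^sup>2) / 4)"
      by (simp add: norm_mult norm_L2_inner_coherent_state norm_minus_commute[of X Z] mult.assoc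
            add_divide_distrib diff_divide_distrib flip: exp_add)
    also have "- ((norm (Z - X))\<^sup>2 + (norm (Z - Y))\<^sup>2) / 4 =
        - (norm (X - Y))\<^sup>2 / 8 + - (1/2) * (norm (Z - ?M))\<^sup>2"
      unfolding parallelogram_midpoint by simp
    finally have eq: "norm (?F Z) = norm (G Z) *
        exp (- (norm (X - Y))\<^sup>2 / 8 + - (1/2) * (norm (Z - ?M))\<^sup>2)" .
    show ?thesis
      unfolding eq exp_add by (rule mult_right_mono[OF G_le]) simp
  qed
  have gauss: "has_bochner_integral lborel
      (\<lambda>Z. sup_norm G * (?E * exp (- (1/2) * (norm (Z - ?M))\<^sup>2)))
      (sup_norm G * (?E * (2 * pi) ^ CARD('n)))"
  proof -
    \<comment> \<open>Phase space has dimension 2n, so the 2n square roots pair up into n factors 2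
      pi.\<close>
    have "sqrt (pi / (1/2)) ^ DIM((real ^ 'n) \<times> (real ^ 'n)) = (2 * pi) ^ CARD('n)"
      by (simp add: power_mult flip: mult_2)
    then show ?thesis
      using has_bochner_integral_gaussian_norm[of "1/2" ?M]
      by (intro has_bochner_integral_mult_right) simp
  qed
  have "norm (integral\<^sup>L lborel ?F) \<le> sup_norm G * (?E * (2 * pi) ^ CARD('n))"
  proof -
    have "norm (integral\<^sup>L lborel ?F) \<le> (LINT Z|lborel. norm (?F Z))"
      by (rule integral_norm_bound)
    also have "\<dots> \<le> (LINT Z|lborel. sup_norm G * (?E * exp (- (1/2) * (norm (Z - ?M))\<^sup>2)))"
      \<comment> \<open>\<open>integral_mono'\<close> takes integrability and nonnegativity from the
        majorant; the latter holds because the majorant dominates a norm.\<close>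
      using gauss F_le order_trans[OF norm_ge_zero F_le]
      by (intro integral_mono') (simp_all only: has_bochner_integral_iff)
    also have "\<dots> = sup_norm G * (?E * (2 * pi) ^ CARD('n))"
      using gauss by (rule has_bochner_integral_integral_eq)
    finally show ?thesis .
  qed
  then have "inverse ((2 * pi) ^ CARD('n)) * norm (integral\<^sup>L lborel ?F) \<le>
      inverse ((2 * pi) ^ CARD('n)) * (sup_norm G * (?E * (2 * pi) ^ CARD('n)))"
    by (rule mult_left_mono) simp
  also have "\<dots> = sup_norm G * ?E"
    by (simp add: field_simps)
  finally have "inverse ((2 * pi) ^ CARD('n)) * norm (integral\<^sup>L lborel ?F) \<le> sup_norm G * ?E" .
  moreover have "L2_inner (A (coherent_state X)) (coherent_state Y) =
      of_real (inverse ((2 * pi) ^ CARD('n))) * integral\<^sup>L lborel ?F"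
    using \<open>is_anti_wick_operator G A\<close> coherent_state_L2
    unfolding is_anti_wick_operator_def by blast
  ultimately show "norm (L2_inner (A (coherent_state X)) (coherent_state Y)) \<le> sup_norm G * ?E"
    by (simp only: norm_mult norm_of_real) simp
qed

end
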